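(* Let $\rho$ be a density operator (pure or mixed) on $\mathbb{C}^2\otimes\mathbb{C}^2$ with correlation matrix $c_{ij}=\mathrm{Tr}(\rho\,\sigma_i\otimes\sigma_j)$, $i,j\in\{1,2,3\}$. If $\sum_{i,j=1}^3 c_{ij}^2>1$, then the partial transpose $(\mathbf 1\otimes T)\rho$ has a negative expectation value with some maximally entangled state, i.e. there is a maximally entangled unit vector $|\Phi\rangle\in\mathbb{C}^2\otimes\mathbb{C}^2$ with $\langle\Phi|\,(\mathbf 1\otimes T)\rho\,|\Phi\rangle<0$; hence $(\mathbf 1\otimes T)\rho$ is not positive semidefinite.
   Context: $\sigma_1,\sigma_2,\sigma_3$ are the Pauli matrices $\sigma_x,\sigma_y,\sigma_z$. A density operator is a positive semidefinite operator of trace one. $T$ is matrix transposition in the standard basis of $\mathbb{C}^2$ (the eigenbasis of $\sigma_z$), and $(\mathbf 1\otimes T)(X\otimes Y)=X\otimes Y^{\mathrm T}$, extended linearly. A unit vector in $\mathbb{C}^2\otimes\mathbb{C}^2$ is maximally entangled if both of its reduced density operators equal $\frac12\mathbf 1$ (equivalently, it is obtained from a Bell state such as $\frac1{\sqrt2}(|00\rangle+|11\rangle)$ by a local unitary $U_1\otimes U_2$). *)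

theory Defs
  imports "HOL-Analysis.Analysis"
begin

text \<open>
  Operators on $C^2 \otimes C^2$ are matrices indexed by the product type \<open>2 \<times> 2\<close>; the entry in
  row \<open>(i,k)\<close> and column \<open>(j,l)\<close> is \<open>A $ (i,k) $ (j,l)\<close>. The indices \<open>1, 2\<close> of type
  \<^typ>\<open>2\<close> stand for the basis vectors $|0\rangle$, $|1\rangle$, the eigenvectors of $\sigma_z$.
  Inequalities between complex numbers are those of \<open>HOL-Library.Complex_Order\<close>: \<open>x \<le> y\<close> and
  \<open>x < y\<close> include the condition \<open>Im x = Im y\<close>.
\<close>

type_synonym qubit_op = "complex^2^2"
type_synonym two_qubit_vec = "complex^(2 \<times> 2)"
type_synonym two_qubit_op = "complex^(2 \<times> 2)^(2 \<times> 2)"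

definition sigma_x :: qubit_op where
  "sigma_x = vector [vector [0, 1], vector [1, 0]]"

definition sigma_y :: qubit_op where
  "sigma_y = vector [vector [0, -\<i>], vector [\<i>, 0]]"

definition sigma_z :: qubit_op where
  "sigma_z = vector [vector [1, 0], vector [0, -1]]"

text \<open>The indices are the elements \<open>1, 2, 3\<close> of type \<^typ>\<open>3\<close>, where \<open>3 = 0\<close>.\<close>

definition pauli :: "3 \<Rightarrow> qubit_op" where
  "pauli i = (if i = 1 then sigma_x else if i = 2 then sigma_y else sigma_z)"

definition tensor_op ::
    "complex^'n^'n \<Rightarrow> complex^'m^'m \<Rightarrow> complex^('n \<times> 'm)^('n \<times> 'm)" (infixr "\<otimes>\<^sub>o" 75) where
  "A \<otimes>\<^sub>o B = (\<chi> r c. A $ fst r $ fst c * B $ snd r $ snd c)"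

text \<open>Antilinear in the first argument, as in Dirac notation.\<close>

definition braket :: "complex^'n \<Rightarrow> complex^'n \<Rightarrow> complex" where
  "braket u v = (\<Sum>i\<in>UNIV. cnj (u $ i) * v $ i)"

definition expectation_value :: "complex^'n^'n \<Rightarrow> complex^'n \<Rightarrow> complex" where
  "expectation_value A v = braket v (A *v v)"

definition ketbra :: "complex^'n \<Rightarrow> complex^'n^'n" where
  "ketbra v = (\<chi> i j. v $ i * cnj (v $ j))"

text \<open>Hermiticity is implied by the reality of all \<open>expectation_value A v\<close>; see
  \<open>positive_semidefinite_hermitian\<close> below.\<close>

definition positive_semidefinite :: "complex^'n^'n \<Rightarrow> bool" where
  "positive_semidefinite A \<longleftrightarrow> (\<forall>v. 0 \<le> expectation_value A v)"

definition density_operator :: "complex^'n^'n \<Rightarrow> bool" where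
  "density_operator \<rho> \<longleftrightarrow> positive_semidefinite \<rho> \<and> trace \<rho> = 1"

text \<open>The trace below is real for every density operator, so taking the real part only changes
  the type; see \<open>of_real_correlation_matrix\<close>.\<close>

definition correlation_matrix :: "two_qubit_op \<Rightarrow> real^3^3" where
  "correlation_matrix \<rho> = (\<chi> i j. Re (trace (\<rho> ** (pauli i \<otimes>\<^sub>o pauli j))))"

text \<open>The linear map $1 \otimes T$, characterized by the three lemmas \<open>partial_transpose_tensor\<close>,
  \<open>partial_transpose_add\<close> and \<open>partial_transpose_scale\<close>.\<close>

definition partial_transpose :: "two_qubit_op \<Rightarrow> two_qubit_op" where
  "partial_transpose A = (\<chi> r c. A $ (fst r, snd c) $ (fst c, snd r))"

definition reduced_fst :: "two_qubit_op \<Rightarrow> qubit_op" where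
  "reduced_fst A = (\<chi> i j. \<Sum>k\<in>UNIV. A $ (i, k) $ (j, k))"

definition reduced_snd :: "two_qubit_op \<Rightarrow> qubit_op" where
  "reduced_snd A = (\<chi> k l. \<Sum>i\<in>UNIV. A $ (i, k) $ (i, l))"

definition maximally_entangled :: "two_qubit_vec \<Rightarrow> bool" where
  "maximally_entangled \<Phi> \<longleftrightarrow> norm \<Phi> = 1 \<and>
     reduced_fst (ketbra \<Phi>) = (1/2) *\<^sub>R mat 1 \<and> reduced_snd (ketbra \<Phi>) = (1/2) *\<^sub>R mat 1"


lemma partial_transpose_tensor: "partial_transpose (X \<otimes>\<^sub>o Y) = X \<otimes>\<^sub>o transpose Y"
  by (simp add: partial_transpose_def tensor_op_def transpose_def vec_eq_iff)

lemma partial_transpose_add: "partial_transpose (A + B) = partial_transpose A + partial_transpose B"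
  by (simp add: partial_transpose_def vec_eq_iff)

lemma partial_transpose_scale: "partial_transpose (\<chi> r c. a * A $ r $ c) = (\<chi> r c. a * partial_transpose A $ r $ c)"
  by (simp add: partial_transpose_def vec_eq_iff)

lemma positive_semidefinite_hermitian:
  assumes "positive_semidefinite A"
  shows "A $ a $ b = cnj (A $ b $ a)"
proof -
  have im: "Im (expectation_value A v) = 0" for v
    using assms by (simp add: positive_semidefinite_def less_eq_complex_def)
  define f where "f u v = braket u (A *v v)" for u v
  have add: "f (u + u') v = f u v + f u' v" "f u (v + v') = f u v + f u v'" for u u' v v'
    by (simp_all add: f_def braket_def matrix_vector_right_distrib algebra_simps sum.distrib)
  have ax: "f (axis i x) (axis j y) = cnj x * A $ i $ j * y" for i j x y
  proof -
    have "(A *v axis j y) $ i = A $ i $ j * y" for i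
      by (simp add: matrix_vector_mult_def axis_def if_distrib cong: if_cong)
    then show ?thesis
      by (simp add: f_def braket_def axis_def if_distrib if_distribR cong: if_cong)
  qed
  have E: "Im (f v v) = 0" for v
    using im[of v] by (simp add: expectation_value_def f_def)
  have d: "Im (A $ i $ i) = 0" for i
    using E[of "axis i 1"] by (simp add: ax)
  have 1: "Im (A $ a $ b) + Im (A $ b $ a) = 0"
    using E[of "axis a 1 + axis b 1"] by (simp add: add ax d)
  have 2: "Re (A $ a $ b) - Re (A $ b $ a) = 0"
    using E[of "axis a 1 + axis b \<i>"] by (simp add: add ax d)
  show ?thesis using 1 2 by (simp add: complex_eq_iff)
qed

lemma of_real_correlation_matrix:
  assumes "density_operator \<rho>"
  shows "complex_of_real (correlation_matrix \<rho> $ i $ j) = trace (\<rho> ** (pauli i \<otimes>\<^sub>o pauli j))"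
proof -
  have h: "cnj (\<rho> $ a $ b) = \<rho> $ b $ a" for a b
    using assms positive_semidefinite_hermitian[of \<rho> b a] by (simp add: density_operator_def)
  have "cnj (pauli k $ a $ b) = pauli k $ b $ a" for k a b
    using exhaust_2[of a] exhaust_2[of b]
    by (auto simp: pauli_def sigma_x_def sigma_y_def sigma_z_def)
  then have "cnj (trace (\<rho> ** (pauli i \<otimes>\<^sub>o pauli j))) =
      (\<Sum>r\<in>UNIV. \<Sum>c\<in>UNIV. \<rho> $ c $ r * (pauli i \<otimes>\<^sub>o pauli j) $ r $ c)"
    by (simp add: trace_def matrix_matrix_mult_def h tensor_op_def)
  also have "\<dots> = trace (\<rho> ** (pauli i \<otimes>\<^sub>o pauli j))"
    by (subst sum.swap) (simp add: trace_def matrix_matrix_mult_def)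
  finally have "trace (\<rho> ** (pauli i \<otimes>\<^sub>o pauli j)) \<in> \<real>"
    by (simp add: Reals_cnj_iff)
  then show ?thesis by (simp add: correlation_matrix_def)
qed

end

theory Submission
  imports Defs
begin

text \<open>
  A unit quaternion \<open>x\<close> gives a unitary $U_x$ and hence two maximally entangled vectors: the
  image of $(|00\rangle+|11\rangle)/\sqrt 2$ under $U_x \otimes 1$ and the image of the singlet.
  With $R_x$ the rotation belonging to \<open>x\<close>, the first has expectation value
  $(1 + \langle R_x, c\rangle)/4$ in the partial transpose of $\rho$, and the second has
  expectation value $(1 - \langle R_x, c\rangle)/4 \ge 0$ in $\rho$ itself. Now
  $\langle R_x, c\rangle = x \cdot K x$ for a symmetric real $4 \times 4$ matrix \<open>K\<close> that is linear
  in \<open>c\<close> and satisfies $\|K\|^2 = 4 \|c\|^2$ in the Frobenius norm. If the first expectation values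
  were all nonnegative too, then $|x \cdot K x| \le 1$ for all unit \<open>x\<close>, so every column of \<open>K\<close>
  would have norm at most 1 and $4 \|c\|^2 \le 4$.
\<close>

text \<open>Polarization replaces eigenvalues: for \<open>x = axis j 1\<close> and
  \<open>y = A *v x\<close>, the form at \<open>x + y\<close> minus the form at \<open>x - y\<close>
  is 4 |y|^2, while the bound limits it to |x + y|^2 + |x - y|^2 = 2 + 2 |y|^2.\<close>

lemma symmetric_matrix_column_norm_le:
  fixes A :: "real^'n^'n"
  assumes sym: "transpose A = A"
    and bound: "\<And>x. norm x = 1 \<Longrightarrow> \<bar>x \<bullet> (A *v x)\<bar> \<le> 1"
  shows "norm (column j A) \<le> 1"
proof -
  have quad: "\<bar>x \<bullet> (A *v x)\<bar> \<le> x \<bullet> x" for x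
  proof (cases "x = 0")
    case False
    have "x \<bullet> (A *v x) = (norm x)\<^sup>2 * (sgn x \<bullet> (A *v sgn x))"
      using False by (simp add: sgn_div_norm matrix_vector_mult_scaleR power2_eq_square field_simps)
    moreover have "\<bar>sgn x \<bullet> (A *v sgn x)\<bar> \<le> 1"
      using False by (intro bound) (simp add: norm_sgn)
    ultimately show ?thesis
      by (simp add: abs_mult power2_norm_eq_inner[symmetric] mult_left_le)
  qed simp
  define x y where "x = axis j (1::real)" and "y = A *v x"
  have "x \<bullet> (A *v y) = (A *v x) \<bullet> y"
    using dot_lmul_matrix[of x A y] sym
    by (metis transpose_matrix_vector)
  then have "(x + y) \<bullet> (A *v (x + y)) - (x - y) \<bullet> (A *v (x - y)) = 4 * (y \<bullet> y)"
    by (simp add: y_def matrix_vector_right_distrib matrix_vector_mult_diff_distrib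
        inner_add inner_diff inner_commute)
  moreover have "(x + y) \<bullet> (x + y) + (x - y) \<bullet> (x - y) = 2 + 2 * (y \<bullet> y)"
    by (simp add: inner_add inner_diff inner_commute x_def inner_axis_axis)
  ultimately have "y \<bullet> y \<le> 1"
    using quad[of "x + y"] quad[of "x - y"] by linarith
  then show ?thesis
    by (simp add: x_def y_def matrix_vector_mult_basis norm_eq_sqrt_inner)
qed

lemma sum_UNIV_2x2: "sum f (UNIV :: (2 \<times> 2) set) = f (1,1) + f (1,2) + f (2,1) + f (2,2)"
  unfolding UNIV_Times_UNIV[symmetric] sum.cartesian_product' by (simp add: sum_2 add.assoc)

lemma expectation_value_hermitian_real:
  assumes "\<And>a b. A $ a $ b = cnj (A $ b $ a)"
  shows "Im (expectation_value A v) = 0"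
proof -
  have "cnj (expectation_value A v) = (\<Sum>i\<in>UNIV. \<Sum>j\<in>UNIV. v $ i * A $ j $ i * cnj (v $ j))"
    unfolding expectation_value_def braket_def matrix_vector_mult_def
    by (subst (2) assms) (simp add: sum_distrib_left mult.assoc)
  also have "\<dots> = expectation_value A v"
    unfolding expectation_value_def braket_def matrix_vector_mult_def
    by (subst sum.swap) (simp add: sum_distrib_left mult_ac)
  finally show ?thesis by (simp add: complex_eq_iff)
qed

text \<open>$U_x = x_1 - i (x_2 \sigma_x + x_3 \sigma_y + x_4 \sigma_z)$; its rotation is
  $U_x \sigma_i U_x^* = \sum_j (R_x)_{ji} \sigma_j$.\<close>

definition quaternion_unitary :: "real^4 \<Rightarrow> qubit_op" where
  "quaternion_unitary x = vector
     [vector [Complex (x$1) (- x$4), Complex (- x$3) (- x$2)],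
      vector [Complex (x$3) (- x$2), Complex (x$1) (x$4)]]"

text \<open>Applying U to the first factor of the Bell state makes the entries of U / sqrt 2 the
  amplitudes.\<close>

definition rotated_bell :: "real^4 \<Rightarrow> two_qubit_vec" where
  "rotated_bell x = (1 / sqrt 2) *\<^sub>R (\<chi> p. quaternion_unitary x $ fst p $ snd p)"

text \<open>The singlet is (|01> - |10>) / sqrt 2; this is its image under U on the first
  factor.\<close>

definition rotated_singlet :: "real^4 \<Rightarrow> two_qubit_vec" where
  "rotated_singlet x = (1 / sqrt 2) *\<^sub>R
     (\<chi> p. if snd p = 1 then - quaternion_unitary x $ fst p $ 2 else quaternion_unitary x $ fst p $ 1)"

text \<open>Davenport's traceless K matrix, known from fitting rotations by quaternions.\<close>

definition quaternion_form :: "real^3^3 \<Rightarrow> real^4^4" where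
  "quaternion_form c = vector
    [vector [c$1$1 + c$2$2 + c$3$3, c$3$2 - c$2$3, c$1$3 - c$3$1, c$2$1 - c$1$2],
     vector [c$3$2 - c$2$3, c$1$1 - c$2$2 - c$3$3, c$1$2 + c$2$1, c$1$3 + c$3$1],
     vector [c$1$3 - c$3$1, c$1$2 + c$2$1, c$2$2 - c$1$1 - c$3$3, c$2$3 + c$3$2],
     vector [c$2$1 - c$1$2, c$1$3 + c$3$1, c$2$3 + c$3$2, c$3$3 - c$1$1 - c$2$2]]"

lemma vector_4:
  "(vector [a, b, c, d] :: 'a::zero^4) $ 1 = a"
  "(vector [a, b, c, d] :: 'a^4) $ 2 = b"
  "(vector [a, b, c, d] :: 'a^4) $ 3 = c"
  "(vector [a, b, c, d] :: 'a^4) $ 4 = d"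
  by (simp_all add: vector_def)

lemma transpose_quaternion_form: "transpose (quaternion_form c) = quaternion_form c"
  by (simp add: vec_eq_iff forall_4 transpose_def quaternion_form_def vector_4)

text \<open>On the diagonal the sign patterns are orthogonal, so the mixed products cancel; off it,
  each (a - b)^2 pairs with (a + b)^2, and both occur twice.\<close>

lemma sum_columns_quaternion_form:
  "(\<Sum>j\<in>UNIV. (norm (column j (quaternion_form c)))\<^sup>2) = 4 * (\<Sum>i\<in>UNIV. \<Sum>j\<in>UNIV. (c $ i $ j)\<^sup>2)"
  unfolding power2_norm_eq_inner inner_vec_def
  by (simp add: column_def sum_4 sum_3 quaternion_form_def vector_4 power2_eq_square algebra_simps)

lemma inner_self_real4: "(x::real^4) \<bullet> x = (x$1)\<^sup>2 + (x$2)\<^sup>2 + (x$3)\<^sup>2 + (x$4)\<^sup>2"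
  by (simp add: inner_vec_def sum_4 power2_eq_square)

lemma expectation_value_scaleR: "expectation_value A (r *\<^sub>R v) = r\<^sup>2 *\<^sub>R expectation_value A v"
  by (simp add: expectation_value_def braket_def matrix_vector_mult_def power2_eq_square
      scaleR_conv_of_real[where 'a=complex] sum_distrib_left mult_ac)

lemma ketbra_scaleR: "ketbra (r *\<^sub>R v) = r\<^sup>2 *\<^sub>R ketbra v"
  by (simp add: ketbra_def vec_eq_iff power2_eq_square)

text \<open>The reduced operators are U U^* / 2 and the transpose of U^* U / 2, and U is unitary for
  unit \<open>x\<close>.\<close>

lemma maximally_entangled_rotated_bell:
  assumes "norm x = 1"
  shows "maximally_entangled (rotated_bell x)"
proof -
  have 1: "(x$1)\<^sup>2 + (x$2)\<^sup>2 + (x$3)\<^sup>2 + (x$4)\<^sup>2 = 1"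
    using assms by (simp add: inner_self_real4[symmetric] norm_eq_1)
  define v :: two_qubit_vec where "v = (\<chi> p. quaternion_unitary x $ fst p $ snd p)"
  have v: "v $ (1,1) = Complex (x$1) (- x$4)" "v $ (1,2) = Complex (- x$3) (- x$2)"
    "v $ (2,1) = Complex (x$3) (- x$2)" "v $ (2,2) = Complex (x$1) (x$4)"
    by (simp_all add: v_def quaternion_unitary_def)
  have "v \<bullet> v = 2"
    using 1 by (simp add: inner_vec_def sum_UNIV_2x2 v inner_complex_def power2_eq_square)
  moreover have "reduced_fst (ketbra v) = mat 1"
    using 1 by (simp add: reduced_fst_def ketbra_def vec_eq_iff forall_2 sum_2 v mat_def
        complex_eq_iff power2_eq_square algebra_simps)
  moreover have "reduced_snd (ketbra v) = mat 1"
    using 1 by (simp add: reduced_snd_def ketbra_def vec_eq_iff forall_2 sum_2 v mat_def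
        complex_eq_iff power2_eq_square algebra_simps)
  ultimately show ?thesis
    unfolding maximally_entangled_def rotated_bell_def v_def[symmetric] ketbra_scaleR
    by (simp add: norm_eq_sqrt_inner power_divide reduced_fst_def reduced_snd_def vec_eq_iff
        scaleR_sum_right[symmetric])
qed

lemma correlation_matrix_sum:
  "correlation_matrix \<rho> $ i $ j = Re (\<Sum>a\<in>UNIV. \<Sum>b\<in>UNIV. \<Sum>c\<in>UNIV. \<Sum>d\<in>UNIV.
     \<rho> $ (a, b) $ (c, d) * (pauli i $ c $ a * pauli j $ d $ b))"
  by (simp add: correlation_matrix_def trace_def matrix_matrix_mult_def tensor_op_def
      sum.cartesian_product' flip: UNIV_Times_UNIV)

lemma pauli_entries:
  "pauli 1 $ 1 $ 1 = 0" "pauli 1 $ 1 $ 2 = 1" "pauli 1 $ 2 $ 1 = 1" "pauli 1 $ 2 $ 2 = 0"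
  "pauli 2 $ 1 $ 1 = 0" "pauli 2 $ 1 $ 2 = - \<i>" "pauli 2 $ 2 $ 1 = \<i>" "pauli 2 $ 2 $ 2 = 0"
  "pauli 3 $ 1 $ 1 = 1" "pauli 3 $ 1 $ 2 = 0" "pauli 3 $ 2 $ 1 = 0" "pauli 3 $ 2 $ 2 = - 1"
  by (simp_all add: pauli_def sigma_x_def sigma_y_def sigma_z_def)

lemma inner_quaternion_form:
  "x \<bullet> (quaternion_form c *v x) =
     ((x$1)\<^sup>2 + (x$2)\<^sup>2 - (x$3)\<^sup>2 - (x$4)\<^sup>2) * c$1$1
   + ((x$1)\<^sup>2 - (x$2)\<^sup>2 + (x$3)\<^sup>2 - (x$4)\<^sup>2) * c$2$2
   + ((x$1)\<^sup>2 - (x$2)\<^sup>2 - (x$3)\<^sup>2 + (x$4)\<^sup>2) * c$3$3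
   + 2 * (x$2 * x$3 - x$1 * x$4) * c$1$2 + 2 * (x$2 * x$3 + x$1 * x$4) * c$2$1
   + 2 * (x$2 * x$4 + x$1 * x$3) * c$1$3 + 2 * (x$2 * x$4 - x$1 * x$3) * c$3$1
   + 2 * (x$3 * x$4 - x$1 * x$2) * c$2$3 + 2 * (x$3 * x$4 + x$1 * x$2) * c$3$2"
  by (simp add: inner_vec_def matrix_vector_mult_def sum_4 quaternion_form_def vector_4
      power2_eq_square algebra_simps)

text \<open>The Bell projector is (1 + XX - YY + ZZ) / 4. Transposing its second factor flips the
  sign of YY, and conjugating the first factor by U then rotates the Pauli matrices by R_x.\<close>

lemma Re_expectation_partial_transpose_rotated_bell:
  "Re (expectation_value (partial_transpose \<rho>) (rotated_bell x)) =
     (Re (trace \<rho>) * (x \<bullet> x) + x \<bullet> (quaternion_form (correlation_matrix \<rho>) *v x)) / 4"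
  unfolding rotated_bell_def expectation_value_scaleR inner_quaternion_form inner_self_real4
    correlation_matrix_sum sum_2 pauli_entries
  by (simp add: expectation_value_def braket_def matrix_vector_mult_def sum_UNIV_2x2
      partial_transpose_def quaternion_unitary_def trace_def power_divide power2_eq_square
      algebra_simps)

text \<open>The singlet projector (1 - XX - YY - ZZ) / 4 already has equal signs, so no
  transposition is involved.\<close>

lemma Re_expectation_rotated_singlet:
  "Re (expectation_value \<rho> (rotated_singlet x)) =
     (Re (trace \<rho>) * (x \<bullet> x) - x \<bullet> (quaternion_form (correlation_matrix \<rho>) *v x)) / 4"
  unfolding rotated_singlet_def expectation_value_scaleR inner_quaternion_form inner_self_real4
    correlation_matrix_sum sum_2 pauli_entries
  by (simp add: expectation_value_def braket_def matrix_vector_mult_def sum_UNIV_2x2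
      quaternion_unitary_def trace_def power_divide power2_eq_square
      algebra_simps)

theorem mainTheorem4:
  fixes \<rho> :: "complex^(2 \<times> 2)^(2 \<times> 2)"
  assumes "density_operator \<rho>"
    and "(\<Sum>i\<in>UNIV. \<Sum>j\<in>UNIV. (correlation_matrix \<rho> $ i $ j)\<^sup>2) > 1"
  shows "(\<exists>\<Phi>. maximally_entangled \<Phi> \<and> expectation_value (partial_transpose \<rho>) \<Phi> < 0)
       \<and> \<not> positive_semidefinite (partial_transpose \<rho>)"
proof -
  let ?K = "quaternion_form (correlation_matrix \<rho>)"
  have pos: "positive_semidefinite \<rho>" and tr: "trace \<rho> = 1"
    using assms(1) by (simp_all add: density_operator_def)
  have herm: "partial_transpose \<rho> $ a $ b = cnj (partial_transpose \<rho> $ b $ a)" for a b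
    using positive_semidefinite_hermitian[OF pos, of "(fst a, snd b)" "(fst b, snd a)"]
    by (simp add: partial_transpose_def)
  have "\<exists>x. norm x = 1 \<and> Re (expectation_value (partial_transpose \<rho>) (rotated_bell x)) < 0"
  proof (rule ccontr)
    assume "\<not> ?thesis"
    then have nonneg: "0 \<le> Re (expectation_value (partial_transpose \<rho>) (rotated_bell x))"
      if "norm x = 1" for x
      using that by (meson not_less)
    have "\<bar>x \<bullet> (?K *v x)\<bar> \<le> 1" if "norm x = 1" for x
    proof -
      \<comment> \<open>This gives the upper bound 1 on the form; \<open>nonneg\<close> gives the
        lower bound -1.\<close>
      have "0 \<le> Re (expectation_value \<rho> (rotated_singlet x))"
        using pos by (simp add: positive_semidefinite_def less_eq_complex_def)
      then show ?thesis
        using nonneg[OF that] that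
        by (simp add: Re_expectation_partial_transpose_rotated_bell
            Re_expectation_rotated_singlet tr norm_eq_1)
    qed
    then have "norm (column j ?K) \<le> 1" for j
      by (intro symmetric_matrix_column_norm_le transpose_quaternion_form)
    then have "(\<Sum>j\<in>UNIV. (norm (column j ?K))\<^sup>2) \<le> (\<Sum>j\<in>(UNIV::4 set). 1)"
      by (intro sum_mono) (simp add: power_le_one)
    then show False
      using assms(2) unfolding sum_columns_quaternion_form by simp
  qed
  then obtain x where x: "norm x = 1"
    and neg: "Re (expectation_value (partial_transpose \<rho>) (rotated_bell x)) < 0"
    by blast
  \<comment> \<open>The complex order also demands a zero imaginary part, which \<open>herm\<close>
    supplies.\<close>
  have "expectation_value (partial_transpose \<rho>) (rotated_bell x) < 0"
    using neg expectation_value_hermitian_real[OF herm] by (simp add: less_complex_def)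
  then show ?thesis
    using maximally_entangled_rotated_bell[OF x]
    by (auto simp: positive_semidefinite_def dest: leD)
qed

end
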